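(* Let $\alpha, \beta > 0$ and let the limit $n > 0$. Then, for coin bias $p\in[0,1]$ and $q = 1-p$, the probability $I(p\,|\,n,\alpha,\beta)$ that the first player wins the game is \[ I(p\,|\,n,\alpha,\beta) = \frac{1}{2}\left(1+ \sum_k P(\tau_1 = k)^2\right), \] where the sum can be restricted to integers $k$ with $\lceil n/(\alpha + \beta) \rceil \le k \le \lceil n/\alpha \rceil$, and for such $k$ \[ P(\tau_1 = k ) = \binom{k-1}{i_k}\, p^{i_k+1}q^{k-i_k-1} + \sum_{j=i_k+1}^{i^*_k} \binom{k-1}{j}\, p^j q^{k-j-1}, \] with $i_k=\lceil (n - k\alpha)/\beta - 1 \rceil$ and $i^*_k =\lceil (n - (k-1)\alpha)/\beta - 1 \rceil$.
   Context: The game: two players alternate turns, the first player going first. On each turn the current player tosses a biased coin (all tosses independent) with probability $p$ of heads and $q=1-p$ of tails, and is awarded $\alpha$ points for tails and $\alpha+\beta$ points for heads. The first player to accumulate $n$ or more points wins. The values $\alpha,\beta,n$ are positive constants. $I(p\,|\,n,\alpha,\beta)$ denotes the probability that the player who goes first wins. $\tau_1$ is the stopping time equal to the number of the first player's own tosses at which the first player's accumulated points first reach $n$ or more (the first player is regarded as continuing to toss regardless of the other player). Conventions: $\binom{k-1}{i}=0$ when $i\notin\{0,1,\dots,k-1\}$, and any term with a zero binomial coefficient is zero; $0^0=1$; a sum whose upper limit is less than its lower limit is empty (this occurs when $i_k^*=i_k$). *)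

theory Defs
  imports "HOL-Probability.Probability"
begin

datatype player = First | Second

text \<open>Turns are numbered from 0: the first player tosses on the even turns and the second player
on the odd ones.\<close>

fun turn_of :: "player \<Rightarrow> nat \<Rightarrow> nat" where
  "turn_of First j = 2 * j"
| "turn_of Second j = 2 * j + 1"

text \<open>An outcome assigns to each turn the result of its toss, with \<open>True\<close> for heads. The players are
regarded as tossing forever; the rules of the game only look at the turns up to its end.\<close>

type_synonym outcome = "nat \<Rightarrow> bool"

definition toss_space :: "real \<Rightarrow> outcome measure" where
  "toss_space p = (\<Pi>\<^sub>M t\<in>UNIV. measure_pmf (bernoulli_pmf p))"

definition award :: "real \<Rightarrow> real \<Rightarrow> bool \<Rightarrow> real" where
  "award \<alpha> \<beta> heads = (if heads then \<alpha> + \<beta> else \<alpha>)"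

text \<open>Points of a player after the first \<open>t\<close> turns of the game (turns of both players counted).\<close>

definition score :: "real \<Rightarrow> real \<Rightarrow> outcome \<Rightarrow> player \<Rightarrow> nat \<Rightarrow> real" where
  "score \<alpha> \<beta> \<omega> A t = (\<Sum>j | turn_of A j < t. award \<alpha> \<beta> (\<omega> (turn_of A j)))"

text \<open>Player \<open>A\<close> has at least \<open>n\<close> points after \<open>t\<close> turns, and nobody had that many earlier. Only one
score changes per turn, so at most one player can satisfy this.\<close>

definition wins :: "real \<Rightarrow> real \<Rightarrow> real \<Rightarrow> outcome \<Rightarrow> player \<Rightarrow> bool" where
  "wins n \<alpha> \<beta> \<omega> A \<longleftrightarrow> (\<exists>t. n \<le> score \<alpha> \<beta> \<omega> A t \<and> (\<forall>s<t. \<forall>B. score \<alpha> \<beta> \<omega> B s < n))"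

definition first_win_prob :: "real \<Rightarrow> real \<Rightarrow> real \<Rightarrow> real \<Rightarrow> real" where
  "first_win_prob p n \<alpha> \<beta> = \<P>(\<omega> in toss_space p. wins n \<alpha> \<beta> \<omega> First)"

text \<open>Number of a player's own tosses after which that player's points first reach \<open>n\<close>. For
\<open>\<alpha> > 0\<close> such a number exists for every outcome, so \<open>LEAST\<close> is meaningful.\<close>

definition \<tau> :: "real \<Rightarrow> real \<Rightarrow> real \<Rightarrow> player \<Rightarrow> outcome \<Rightarrow> nat" where
  "\<tau> n \<alpha> \<beta> A \<omega> = (LEAST k. n \<le> (\<Sum>j<k. award \<alpha> \<beta> (\<omega> (turn_of A j))))"

definition prob_\<tau>1 :: "real \<Rightarrow> real \<Rightarrow> real \<Rightarrow> real \<Rightarrow> int \<Rightarrow> real" where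
  "prob_\<tau>1 p n \<alpha> \<beta> k = \<P>(\<omega> in toss_space p. int (\<tau> n \<alpha> \<beta> First \<omega>) = k)"

text \<open>Binomial coefficient for integer arguments, zero when the lower index is outside \<open>{0..m}\<close>.\<close>

definition ibinom :: "int \<Rightarrow> int \<Rightarrow> real" where
  "ibinom m i = (if 0 \<le> i \<and> i \<le> m then real (nat m choose nat i) else 0)"

end

theory Submission
  imports Defs
begin

text \<open>
  The two players' toss sequences are independent and each is distributed like a single sequence of
  tosses, so their stopping times \<open>\<tau>\<^sub>1, \<tau>\<^sub>2\<close> are i.i.d. The first player wins iff \<open>\<tau>\<^sub>1 \<le> \<tau>\<^sub>2\<close>, and by
  symmetry this has probability \<open>(1 + P(\<tau>\<^sub>1 = \<tau>\<^sub>2)) / 2\<close>. For the distribution of \<open>\<tau>\<^sub>1\<close>, condition on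
  the number \<open>j\<close> of heads among the first \<open>k - 1\<close> tosses: \<open>\<tau>\<^sub>1 = k\<close> requires \<open>j \<le> i\<^sup>*\<^sub>k\<close>, and then the
  \<open>k\<close>-th toss is irrelevant if \<open>j > i\<^sub>k\<close> and has to be heads if \<open>j = i\<^sub>k\<close>.
\<close>

section \<open>Stopping times of a single toss sequence\<close>

text \<open>Here \<open>x\<close> lists only one player's own tosses, so the same function serves
  both players once \<open>turn_of\<close> has selected their turns.\<close>

definition points :: "real \<Rightarrow> real \<Rightarrow> nat \<Rightarrow> outcome \<Rightarrow> real" where
  "points \<alpha> \<beta> k x = (\<Sum>j<k. award \<alpha> \<beta> (x j))"

definition hitting :: "real \<Rightarrow> real \<Rightarrow> real \<Rightarrow> outcome \<Rightarrow> nat" where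
  "hitting n \<alpha> \<beta> x = (LEAST k. n \<le> points \<alpha> \<beta> k x)"

definition heads :: "nat \<Rightarrow> outcome \<Rightarrow> nat" where
  "heads m x = (\<Sum>j<m. of_bool (x j))"

lemma heads_Suc: "heads (Suc m) x = heads m x + of_bool (x m)"
  by (simp add: heads_def)

lemma heads_le: "heads m x \<le> m"
  by (induction m) (auto simp: heads_def)

lemma heads_cong: "(\<And>j. j < m \<Longrightarrow> x j = y j) \<Longrightarrow> heads m x = heads m y"
  by (simp add: heads_def)

text \<open>Each toss yields \<alpha> and each head an extra \<beta>, so the points depend on
  \<open>x\<close> only through the number of heads. This is what brings in the binomial
  distribution.\<close>

lemma points_eq_heads: "points \<alpha> \<beta> m x = real m * \<alpha> + real (heads m x) * \<beta>"
  by (induction m) (auto simp: points_def heads_def award_def algebra_simps)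

lemma \<tau>_eq_hitting: "\<tau> n \<alpha> \<beta> A \<omega> = hitting n \<alpha> \<beta> (\<lambda>j. \<omega> (turn_of A j))"
  by (simp add: \<tau>_def hitting_def points_def)

lemma points_mono:
  assumes "\<alpha> > 0" "\<beta> > 0" "k \<le> m"
  shows "points \<alpha> \<beta> k x \<le> points \<alpha> \<beta> m x"
  unfolding points_def using assms by (intro sum_mono2) (auto simp: award_def)

lemma points_ge: "\<beta> > 0 \<Longrightarrow> real k * \<alpha> \<le> points \<alpha> \<beta> k x"
  by (simp add: points_eq_heads)

lemma points_le: "\<beta> > 0 \<Longrightarrow> points \<alpha> \<beta> k x \<le> real k * (\<alpha> + \<beta>)"
  using heads_le[of k x] by (simp add: points_eq_heads algebra_simps)

lemma le_points_ceiling: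
  assumes "\<alpha> > 0" "\<beta> > 0"
  shows "n \<le> points \<alpha> \<beta> (nat \<lceil>n / \<alpha>\<rceil>) x"
proof -
  have "n / \<alpha> \<le> real (nat \<lceil>n / \<alpha>\<rceil>)"
    by (rule real_nat_ceiling_ge)
  then have "n \<le> real (nat \<lceil>n / \<alpha>\<rceil>) * \<alpha>"
    using assms by (simp add: pos_divide_le_eq)
  also have "\<dots> \<le> points \<alpha> \<beta> (nat \<lceil>n / \<alpha>\<rceil>) x"
    using assms by (intro points_ge)
  finally show ?thesis .
qed

text \<open>Points never decrease, so the set under \<open>LEAST\<close> is upward closed;
  \<open>le_points_ceiling\<close>, the bound for tails only, makes it nonempty.\<close>

lemma hitting_le_iff:
  assumes "\<alpha> > 0" "\<beta> > 0"
  shows "hitting n \<alpha> \<beta> x \<le> k \<longleftrightarrow> n \<le> points \<alpha> \<beta> k x"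
proof
  assume "hitting n \<alpha> \<beta> x \<le> k"
  moreover have "n \<le> points \<alpha> \<beta> (hitting n \<alpha> \<beta> x) x"
    unfolding hitting_def using le_points_ceiling[OF assms] by (rule LeastI)
  ultimately show "n \<le> points \<alpha> \<beta> k x"
    using points_mono[OF assms] order_trans by blast
next
  assume "n \<le> points \<alpha> \<beta> k x"
  then show "hitting n \<alpha> \<beta> x \<le> k"
    unfolding hitting_def by (rule Least_le)
qed

lemma less_hitting_iff:
  assumes "\<alpha> > 0" "\<beta> > 0"
  shows "k < hitting n \<alpha> \<beta> x \<longleftrightarrow> points \<alpha> \<beta> k x < n"
  using hitting_le_iff[OF assms, of n x k] by linarith

lemma hitting_pos:
  assumes "\<alpha> > 0" "\<beta> > 0" "n > 0"
  shows "hitting n \<alpha> \<beta> x > 0"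
  using assms by (simp add: less_hitting_iff points_def)

lemma hitting_upper:
  assumes "\<alpha> > 0" "\<beta> > 0"
  shows "hitting n \<alpha> \<beta> x \<le> nat \<lceil>n / \<alpha>\<rceil>"
  using le_points_ceiling[OF assms] by (simp add: hitting_le_iff[OF assms])

lemma hitting_lower:
  assumes "\<alpha> > 0" "\<beta> > 0"
  shows "\<lceil>n / (\<alpha> + \<beta>)\<rceil> \<le> int (hitting n \<alpha> \<beta> x)"
proof -
  have "n \<le> points \<alpha> \<beta> (hitting n \<alpha> \<beta> x) x"
    using hitting_le_iff[OF assms] by blast
  also have "\<dots> \<le> real (hitting n \<alpha> \<beta> x) * (\<alpha> + \<beta>)"
    using assms by (intro points_le)
  finally show ?thesis
    using assms by (simp add: ceiling_le_iff pos_divide_le_eq)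
qed

text \<open>\<open>\<lceil>y - 1\<rceil>\<close> is the largest integer strictly below
  \<open>y\<close>. Hence \<open>i'\<close> and \<open>i\<close> are the largest integers
  \<open>h\<close> for which \<open>h\<close> heads leave fewer than \<open>n\<close> points after
  \<open>m\<close> and after \<open>Suc m\<close> tosses. Beyond \<open>i\<close> heads the next
  toss is irrelevant; at exactly \<open>i\<close> it has to be heads.\<close>

lemma hitting_eq_Suc_iff:
  fixes n \<alpha> \<beta> :: real and m :: nat
  defines "i \<equiv> \<lceil>(n - real (Suc m) * \<alpha>) / \<beta> - 1\<rceil>" and "i' \<equiv> \<lceil>(n - real m * \<alpha>) / \<beta> - 1\<rceil>"
  assumes "\<alpha> > 0" "\<beta> > 0"
  shows "hitting n \<alpha> \<beta> x = Suc m \<longleftrightarrow>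
    int (heads m x) = i \<and> x m \<or> int (heads m x) \<in> {i + 1..i'}"
proof -
  let ?h = "int (heads m x)"
  have "hitting n \<alpha> \<beta> x = Suc m \<longleftrightarrow> m < hitting n \<alpha> \<beta> x \<and> hitting n \<alpha> \<beta> x \<le> Suc m"
    by auto
  also have "\<dots> \<longleftrightarrow> points \<alpha> \<beta> m x < n \<and> n \<le> points \<alpha> \<beta> (Suc m) x"
    by (simp add: less_hitting_iff[OF assms(3,4)] hitting_le_iff[OF assms(3,4)])
  also have "points \<alpha> \<beta> m x < n \<longleftrightarrow> real_of_int ?h - 1 < (n - real m * \<alpha>) / \<beta> - 1"
    using assms(4) by (simp add: points_eq_heads pos_less_divide_eq algebra_simps)
  also have "\<dots> \<longleftrightarrow> ?h \<le> i'"
    unfolding i'_def by (simp only: le_ceiling_iff)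
  also have "n \<le> points \<alpha> \<beta> (Suc m) x \<longleftrightarrow>
      (n - real (Suc m) * \<alpha>) / \<beta> - 1 \<le> real_of_int (?h + of_bool (x m) - 1)"
    using assms(4) by (simp add: points_eq_heads heads_Suc pos_divide_le_eq algebra_simps)
  also have "\<dots> \<longleftrightarrow> i + 1 \<le> ?h + of_bool (x m)"
    unfolding i_def by (simp only: ceiling_le_iff[symmetric]) linarith
  finally have *: "hitting n \<alpha> \<beta> x = Suc m \<longleftrightarrow> ?h \<le> i' \<and> i + 1 \<le> ?h + of_bool (x m)" .
  \<comment> \<open>In the case \<open>?h = i\<close> with heads on toss \<open>m\<close>, this
    supplies the bound \<open>?h \<le> i'\<close>.\<close>
  have "i \<le> i'"
    unfolding i_def i'_def using assms(3,4)
    by (intro ceiling_mono diff_right_mono divide_right_mono) auto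
  then show ?thesis
    unfolding * by (cases "x m") auto
qed

section \<open>Winning in terms of the two stopping times\<close>

lemma score_eq_points:
  "score \<alpha> \<beta> \<omega> First t = points \<alpha> \<beta> ((t + 1) div 2) (\<lambda>j. \<omega> (turn_of First j))"
  "score \<alpha> \<beta> \<omega> Second t = points \<alpha> \<beta> (t div 2) (\<lambda>j. \<omega> (turn_of Second j))"
proof -
  have "{j. turn_of First j < t} = {..<(t + 1) div 2}" "{j. turn_of Second j < t} = {..<t div 2}"
    by auto
  then show "score \<alpha> \<beta> \<omega> First t = points \<alpha> \<beta> ((t + 1) div 2) (\<lambda>j. \<omega> (turn_of First j))"
    "score \<alpha> \<beta> \<omega> Second t = points \<alpha> \<beta> (t div 2) (\<lambda>j. \<omega> (turn_of Second j))"
    unfolding score_def points_def by metis+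
qed

text \<open>The \<open>k\<close>-th own toss of \<open>First\<close> comes just before that of
  \<open>Second\<close>, so equal stopping times are decided in favour of
  \<open>First\<close>.\<close>

lemma wins_First_iff:
  assumes "\<alpha> > 0" "\<beta> > 0" "n > 0"
  shows "wins n \<alpha> \<beta> \<omega> First \<longleftrightarrow> \<tau> n \<alpha> \<beta> First \<omega> \<le> \<tau> n \<alpha> \<beta> Second \<omega>"
proof -
  let ?a = "\<tau> n \<alpha> \<beta> First \<omega>" and ?b = "\<tau> n \<alpha> \<beta> Second \<omega>"
  have all_player: "(\<forall>B. P B) \<longleftrightarrow> P First \<and> P Second" for P
    by (metis player.exhaust)
  have "?a > 0"
    using hitting_pos[OF assms] by (simp add: \<tau>_eq_hitting)
  have "wins n \<alpha> \<beta> \<omega> First \<longleftrightarrow>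
      (\<exists>t. ?a \<le> (t + 1) div 2 \<and> (\<forall>s<t. (s + 1) div 2 < ?a \<and> s div 2 < ?b))"
    unfolding wins_def all_player score_eq_points \<tau>_eq_hitting
      hitting_le_iff[OF assms(1,2)] less_hitting_iff[OF assms(1,2)] ..
  also have "\<dots> \<longleftrightarrow> ?a \<le> ?b"
  proof
    assume "\<exists>t. ?a \<le> (t + 1) div 2 \<and> (\<forall>s<t. (s + 1) div 2 < ?a \<and> s div 2 < ?b)"
    then obtain t where t: "?a \<le> (t + 1) div 2" "\<And>s. s < t \<Longrightarrow> s div 2 < ?b"
      by blast
    show "?a \<le> ?b"
    proof (rule ccontr)
      assume "\<not> ?a \<le> ?b"
      \<comment> \<open>After \<open>2 * ?b\<close> turns \<open>Second\<close> has made
        \<open>?b\<close> tosses and thus has \<open>n\<close> points, which is forbidden before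
        \<open>t\<close>.\<close>
      then have "2 * ?b < t"
        using t(1) by linarith
      then show False
        using t(2)[of "2 * ?b"] by simp
    qed
  next
    assume "?a \<le> ?b"
    \<comment> \<open>Counting from 0, the \<open>?a\<close>-th toss of \<open>First\<close> is turn
      \<open>2 * ?a - 2\<close>, so the win occurs after \<open>2 * ?a - 1\<close> turns.\<close>
    then show "\<exists>t. ?a \<le> (t + 1) div 2 \<and> (\<forall>s<t. (s + 1) div 2 < ?a \<and> s div 2 < ?b)"
      using \<open>?a > 0\<close> by (intro exI[of _ "2 * ?a - 1"]) auto
  qed
  finally show ?thesis .
qed

section \<open>The toss space\<close>

lemma prob_space_toss_space: "prob_space (toss_space p)"
  unfolding toss_space_def by (intro prob_space_PiM prob_space_measure_pmf)

lemma space_toss_space [simp]: "space (toss_space p) = UNIV"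
  by (simp add: toss_space_def space_PiM)

text \<open>Removes \<open>p\<close> from the sigma-algebra, so that measurability can be proved
  once on the discrete product.\<close>

lemma sets_toss_space [measurable_cong]:
  "sets (toss_space p) = sets (\<Pi>\<^sub>M t\<in>UNIV. count_space UNIV)"
  unfolding toss_space_def by (intro sets_PiM_cong) auto

lemma distr_toss_space_reindex:
  assumes "inj f"
  shows "distr (toss_space p) (toss_space p) (\<lambda>\<omega> j. \<omega> (f j)) = toss_space p"
  using distr_PiM_reindex[of UNIV "\<lambda>_. measure_pmf (bernoulli_pmf p)" f UNIV] assms
  by (simp add: toss_space_def prob_space_measure_pmf restrict_UNIV)

text \<open>An injective selection from an i.i.d. family has the law of the whole family. With
  \<open>turn_of A\<close> for \<open>f\<close>, a player's own tosses behave like the full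
  sequence.\<close>

lemma prob_toss_reindex:
  assumes "inj f" and P: "Measurable.pred (\<Pi>\<^sub>M t\<in>UNIV. count_space UNIV) P"
  shows "\<P>(\<omega> in toss_space p. P (\<lambda>j. \<omega> (f j))) = \<P>(\<omega> in toss_space p. P \<omega>)"
proof -
  have [measurable]: "Measurable.pred (toss_space p) P"
    using P by (simp cong: measurable_cong_sets add: sets_toss_space)
  have "{\<omega> \<in> space (toss_space p). P \<omega>} \<in> sets (toss_space p)"
    by measurable
  moreover have "(\<lambda>\<omega> j. \<omega> (f j)) \<in> measurable (toss_space p) (\<Pi>\<^sub>M t\<in>UNIV. count_space UNIV)"
    by (intro measurable_PiM_single') (auto simp: space_PiM)
  then have "(\<lambda>\<omega> j. \<omega> (f j)) \<in> measurable (toss_space p) (toss_space p)"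
    by (simp cong: measurable_cong_sets add: sets_toss_space)
  ultimately have "measure (distr (toss_space p) (toss_space p) (\<lambda>\<omega> j. \<omega> (f j)))
      {\<omega> \<in> space (toss_space p). P \<omega>} = \<P>(\<omega> in toss_space p. P (\<lambda>j. \<omega> (f j)))"
    by (subst measure_distr) (auto simp: vimage_def)
  then show ?thesis
    by (simp add: distr_toss_space_reindex[OF assms(1)])
qed

lemma indep_vars_toss_space:
  "prob_space.indep_vars (toss_space p) (\<lambda>_. count_space UNIV) (\<lambda>t \<omega>. \<omega> t) UNIV"
proof -
  interpret prob_space "toss_space p"
    by (rule prob_space_toss_space)
  have "indep_vars (\<lambda>_. measure_pmf (bernoulli_pmf p)) (\<lambda>t \<omega>. \<omega> t) UNIV"
  \<comment> \<open>Independence means that the joint law is the product of the marginals; the joint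
    map is the identity and the marginals are the Bernoulli factors.\<close>
  proof (subst indep_vars_iff_distr_eq_PiM)
    have "distr (toss_space p) (measure_pmf (bernoulli_pmf p)) (\<lambda>\<omega>. \<omega> t) =
        measure_pmf (bernoulli_pmf p)" for t
      unfolding toss_space_def by (intro distr_PiM_component prob_space_measure_pmf) auto
    then show "distr (toss_space p) (\<Pi>\<^sub>M t\<in>UNIV. measure_pmf (bernoulli_pmf p)) (\<lambda>\<omega>. \<lambda>t\<in>UNIV. \<omega> t) =
        (\<Pi>\<^sub>M t\<in>UNIV. distr (toss_space p) (measure_pmf (bernoulli_pmf p)) (\<lambda>\<omega>. \<omega> t))"
      by (simp add: restrict_UNIV toss_space_def)
  qed (auto simp: toss_space_def)
  then show ?thesis
    by (rule indep_vars_compose2[where Y = "\<lambda>_ x. x"]) simp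
qed

text \<open>Functions of disjoint blocks of independent coordinates are independent. The blocks will
  be the earlier tosses against the next one, and the turns of one player against those of the
  other.\<close>

lemma prob_toss_indep:
  assumes "A \<inter> B = {}"
    and F: "Measurable.pred (\<Pi>\<^sub>M t\<in>A. count_space UNIV) F"
    and G: "Measurable.pred (\<Pi>\<^sub>M t\<in>B. count_space UNIV) G"
  shows "\<P>(\<omega> in toss_space p. F (restrict \<omega> A) \<and> G (restrict \<omega> B)) =
    \<P>(\<omega> in toss_space p. F (restrict \<omega> A)) * \<P>(\<omega> in toss_space p. G (restrict \<omega> B))"
proof -
  interpret prob_space "toss_space p"
    by (rule prob_space_toss_space)
  have "indep_var (count_space UNIV) (F \<circ> (\<lambda>\<omega>. restrict \<omega> A)) (count_space UNIV) (G \<circ> (\<lambda>\<omega>. restrict \<omega> B))"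
    using indep_var_compose[OF indep_var_restrict[OF indep_vars_toss_space assms(1)] F G] by simp
  from indep_varD[OF this, of "{True}" "{True}"] show ?thesis
    by (simp add: vimage_def)
qed

lemma prob_toss_heads:
  assumes "p \<in> {0..1}"
  shows "\<P>(\<omega> in toss_space p. \<omega> t) = p"
proof -
  have "measure (distr (toss_space p) (measure_pmf (bernoulli_pmf p)) (\<lambda>\<omega>. \<omega> t)) {True}
      = \<P>(\<omega> in toss_space p. \<omega> t)"
    by (subst measure_distr) (auto simp: toss_space_def vimage_def space_PiM)
  moreover have "distr (toss_space p) (measure_pmf (bernoulli_pmf p)) (\<lambda>\<omega>. \<omega> t) =
      measure_pmf (bernoulli_pmf p)"
    unfolding toss_space_def by (intro distr_PiM_component prob_space_measure_pmf) auto
  ultimately show ?thesis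
    using assms by (simp add: measure_pmf_single)
qed

text \<open>The index set \<open>A\<close> is kept general because \<open>prob_toss_indep\<close>
  asks for measurability on the product over \<open>{..<m}\<close> alone.\<close>

lemma measurable_heads:
  assumes "{..<m} \<subseteq> A"
  shows "heads m \<in> measurable (\<Pi>\<^sub>M t\<in>A. count_space UNIV) (count_space UNIV)"
  using assms
proof (induction m)
  case 0
  then show ?case by (simp add: heads_def)
next
  case (Suc m)
  then have [measurable]: "heads m \<in> measurable (\<Pi>\<^sub>M t\<in>A. count_space UNIV) (count_space UNIV)"
    "m \<in> A"
    by (auto simp: lessThan_Suc)
  have "(\<lambda>x. heads m x + of_bool (x m)) \<in> measurable (\<Pi>\<^sub>M t\<in>A. count_space UNIV) (count_space UNIV)"
    by measurable
  then show ?case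
    by (simp add: heads_Suc[abs_def])
qed

lemma measurable_heads_UNIV [measurable]:
  "heads m \<in> measurable (\<Pi>\<^sub>M t\<in>UNIV. count_space UNIV) (count_space UNIV)"
  by (rule measurable_heads) simp

lemma measurable_hitting [measurable]:
  "hitting n \<alpha> \<beta> \<in> measurable (\<Pi>\<^sub>M t\<in>UNIV. count_space UNIV) (count_space UNIV)"
  unfolding hitting_def points_eq_heads by measurable

lemma measurable_\<tau> [measurable]:
  "\<tau> n \<alpha> \<beta> A \<in> measurable (\<Pi>\<^sub>M t\<in>UNIV. count_space UNIV) (count_space UNIV)"
proof -
  have "(\<lambda>\<omega> j. \<omega> (turn_of A j)) \<in>
      measurable (\<Pi>\<^sub>M t\<in>UNIV. count_space UNIV) (\<Pi>\<^sub>M t\<in>UNIV. (count_space UNIV :: bool measure))"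
    by (intro measurable_PiM_single') (auto simp: space_PiM)
  from measurable_compose[OF this measurable_hitting] show ?thesis
    by (simp add: \<tau>_eq_hitting[abs_def])
qed

section \<open>The distribution of the stopping times\<close>

lemma prob_heads_next:
  "\<P>(\<omega> in toss_space p. heads m \<omega> = j \<and> \<omega> m = b) =
    \<P>(\<omega> in toss_space p. heads m \<omega> = j) * \<P>(\<omega> in toss_space p. \<omega> m = b)"
proof -
  have [measurable]: "heads m \<in> measurable (\<Pi>\<^sub>M t\<in>{..<m}. count_space UNIV) (count_space UNIV)"
    by (rule measurable_heads) simp
  have eq: "heads m (restrict \<omega> {..<m}) = heads m \<omega>" for \<omega>
    by (rule heads_cong) simp
  have "Measurable.pred (\<Pi>\<^sub>M t\<in>{..<m}. count_space UNIV) (\<lambda>\<omega>. heads m \<omega> = j)"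
    by measurable
  moreover have "Measurable.pred (\<Pi>\<^sub>M t\<in>{m}. count_space UNIV) (\<lambda>\<omega>. \<omega> m = b)"
    by measurable
  ultimately show ?thesis
    using prob_toss_indep[of "{..<m}" "{m}" "\<lambda>\<omega>. heads m \<omega> = j" "\<lambda>\<omega>. \<omega> m = b" p]
    by (simp add: eq)
qed

lemma prob_toss_eq:
  assumes "p \<in> {0..1}"
  shows "\<P>(\<omega> in toss_space p. \<omega> t = b) = (if b then p else 1 - p)"
proof -
  interpret prob_space "toss_space p"
    by (rule prob_space_toss_space)
  have "{\<omega> \<in> space (toss_space p). \<omega> t} \<in> events"
    by measurable
  from prob_neg[OF this] show ?thesis
    using prob_toss_heads[OF assms, of t] by (cases b) auto
qed

text \<open>Splits by toss \<open>m\<close>, which is independent of the earlier ones: tails after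
  \<open>j\<close> heads, or heads after \<open>j - 1\<close>.\<close>

lemma prob_heads_Suc:
  assumes "p \<in> {0..1}"
  shows "\<P>(\<omega> in toss_space p. heads (Suc m) \<omega> = j) =
    \<P>(\<omega> in toss_space p. heads m \<omega> = j) * (1 - p) +
    (if j = 0 then 0 else \<P>(\<omega> in toss_space p. heads m \<omega> = j - 1) * p)"
proof -
  interpret prob_space "toss_space p"
    by (rule prob_space_toss_space)
  let ?F = "{\<omega> \<in> space (toss_space p). heads m \<omega> = j \<and> \<omega> m = False}"
  let ?T = "{\<omega> \<in> space (toss_space p). heads m \<omega> = j - 1 \<and> \<omega> m = True}"
  have F: "prob ?F = \<P>(\<omega> in toss_space p. heads m \<omega> = j) * (1 - p)"
    by (subst prob_heads_next, subst prob_toss_eq[OF assms]) simp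
  have T: "prob ?T = \<P>(\<omega> in toss_space p. heads m \<omega> = j - 1) * p"
    by (subst prob_heads_next, subst prob_toss_eq[OF assms]) simp
  show ?thesis
  \<comment> \<open>For \<open>j = 0\<close> the truncated \<open>j - 1\<close> is 0, and
    \<open>?T\<close> would describe one head instead of an impossible event.\<close>
  proof (cases "j = 0")
    case True
    then have "{\<omega> \<in> space (toss_space p). heads (Suc m) \<omega> = j} = ?F"
      by (auto simp: heads_Suc)
    with F True show ?thesis
      by simp
  next
    case False
    then have eq: "{\<omega> \<in> space (toss_space p). heads (Suc m) \<omega> = j} = ?F \<union> ?T"
      by (auto simp: heads_Suc)
    have "?F \<in> events" "?T \<in> events"
      by measurable
    then have "prob (?F \<union> ?T) = prob ?F + prob ?T"
      by (rule finite_measure_Union) auto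
    with False show ?thesis
      unfolding eq F T by simp
  qed
qed

text \<open>The binomial distribution: the recurrence of \<open>prob_heads_Suc\<close> combined with
  Pascal's rule.\<close>

lemma prob_heads:
  assumes "p \<in> {0..1}"
  shows "\<P>(\<omega> in toss_space p. heads m \<omega> = j) = real (m choose j) * p ^ j * (1 - p) ^ (m - j)"
proof (induction m arbitrary: j)
  case 0
  interpret prob_space "toss_space p"
    by (rule prob_space_toss_space)
  show ?case
    using prob_space by (cases j) (auto simp: heads_def)
next
  case (Suc m)
  show ?case
  proof (cases j)
    case 0
    then show ?thesis
      unfolding prob_heads_Suc[OF assms] Suc by simp
  next
    case (Suc i)
    \<comment> \<open>If \<open>i < m\<close>, the extra factor raises the exponent by one;
      otherwise truncated subtraction is harmless because the coefficient vanishes.\<close>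
    have *: "real (m choose Suc i) * p ^ Suc i * (1 - p) ^ (m - Suc i) * (1 - p) =
        real (m choose Suc i) * p ^ Suc i * (1 - p) ^ (m - i)"
    proof (cases "i < m")
      case True
      then have "m - i = Suc (m - Suc i)"
        by simp
      then show ?thesis
        by (simp only: power_Suc mult_ac)
    qed simp
    then show ?thesis
      unfolding prob_heads_Suc[OF assms] Suc.IH Suc * by (simp add: algebra_simps)
  qed
qed

text \<open>For \<open>j\<close> outside \<open>{0..m}\<close> the event is empty and
  \<open>ibinom\<close> is zero, so the values of \<open>powi\<close> at negative exponents never
  matter.\<close>

lemma prob_heads_int:
  assumes "p \<in> {0..1}"
  shows "\<P>(\<omega> in toss_space p. int (heads m \<omega>) = j) =
    ibinom (int m) j * p powi j * (1 - p) powi (int m - j)"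
proof (cases "0 \<le> j \<and> j \<le> int m")
  case True
  then have "\<P>(\<omega> in toss_space p. int (heads m \<omega>) = j) = \<P>(\<omega> in toss_space p. heads m \<omega> = nat j)"
    by (auto intro!: arg_cong[where f = "measure _"])
  moreover have "nat (int m - j) = m - nat j"
    using True by (simp add: nat_diff_distrib)
  ultimately show ?thesis
    unfolding prob_heads[OF assms] using True by (simp add: ibinom_def power_int_def)
next
  case False
  then have "int (heads m \<omega>) \<noteq> j" for \<omega>
    using heads_le[of m \<omega>] by auto
  moreover have "ibinom (int m) j = 0"
    using False by (simp only: ibinom_def if_False)
  ultimately show ?thesis
    by simp
qed

text \<open>Adds up the disjoint events of \<open>hitting_eq_Suc_iff\<close>; the event with exactly
  \<open>i\<close> heads gains a factor \<open>p\<close> from the required head on toss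
  \<open>m\<close>.\<close>

lemma prob_hitting_Suc:
  fixes n \<alpha> \<beta> p :: real and m :: nat
  defines "i \<equiv> \<lceil>(n - real (Suc m) * \<alpha>) / \<beta> - 1\<rceil>" and "i' \<equiv> \<lceil>(n - real m * \<alpha>) / \<beta> - 1\<rceil>"
  assumes "\<alpha> > 0" "\<beta> > 0" "p \<in> {0..1}"
  shows "\<P>(\<omega> in toss_space p. hitting n \<alpha> \<beta> \<omega> = Suc m) =
    ibinom (int m) i * p powi (i + 1) * (1 - p) powi (int m - i) +
    (\<Sum>j = i + 1..i'. ibinom (int m) j * p powi j * (1 - p) powi (int m - j))"
proof -
  interpret prob_space "toss_space p"
    by (rule prob_space_toss_space)
  have "{\<omega> \<in> space (toss_space p). hitting n \<alpha> \<beta> \<omega> = Suc m} =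
      {\<omega> \<in> space (toss_space p). int (heads m \<omega>) = i \<and> \<omega> m} \<union>
      {\<omega> \<in> space (toss_space p). int (heads m \<omega>) \<in> {i + 1..i'}}"
    unfolding i_def i'_def hitting_eq_Suc_iff[OF assms(3,4)] by blast
  also have "prob \<dots> = \<P>(\<omega> in toss_space p. int (heads m \<omega>) = i \<and> \<omega> m) +
      \<P>(\<omega> in toss_space p. int (heads m \<omega>) \<in> {i + 1..i'})"
    by (rule finite_measure_Union) (measurable, auto)
  also have "\<P>(\<omega> in toss_space p. int (heads m \<omega>) \<in> {i + 1..i'}) =
      (\<Sum>j = i + 1..i'. \<P>(\<omega> in toss_space p. int (heads m \<omega>) = j))"
  proof (rule prob_sum)
    show "{\<omega> \<in> space (toss_space p). int (heads m \<omega>) = j} \<in> events"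
      "{\<omega> \<in> space (toss_space p). int (heads m \<omega>) \<in> {i + 1..i'}} \<in> events" for j
      by measurable
  qed auto
  also have "\<P>(\<omega> in toss_space p. int (heads m \<omega>) = i \<and> \<omega> m) =
      \<P>(\<omega> in toss_space p. int (heads m \<omega>) = i) * p"
  \<comment> \<open>\<open>i\<close> is negative when \<open>Suc m\<close> tails alone already give
    \<open>n\<close> points; then no head count equals \<open>i\<close>.\<close>
  proof (cases "i \<ge> 0")
    case True
    then have "int h = i \<longleftrightarrow> h = nat i" for h
      by auto
    then show ?thesis
      using prob_heads_next[of p m "nat i" True] prob_toss_heads[OF assms(5), of m] by simp
  next
    case False
    then have "int h \<noteq> i" for h
      by auto
    then show ?thesis
      by simp
  qed
  also have "\<dots> = ibinom (int m) i * p powi (i + 1) * (1 - p) powi (int m - i)"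
  \<comment> \<open>At \<open>p = 0\<close> and \<open>i = -1\<close> the law
    \<open>p powi (i + 1) = p powi i * p\<close> fails, as \<open>0 powi 0 = 1\<close>; for negative
    \<open>i\<close> the zero coefficient settles the claim instead.\<close>
  proof (cases "i \<ge> 0")
    case True
    then have "p powi (i + 1) = p powi i * p"
      by (simp add: power_int_def nat_add_distrib)
    then show ?thesis
      unfolding prob_heads_int[OF assms(5)] by simp
  next
    case False
    then show ?thesis
      unfolding prob_heads_int[OF assms(5)] by (simp add: ibinom_def)
  qed
  finally show ?thesis
    unfolding prob_heads_int[OF assms(5)] .
qed

section \<open>Common law and independence of the two stopping times\<close>

lemma inj_turn_of: "inj (turn_of A)"
  by (cases A) (auto intro: injI)

lemma prob_\<tau>_eq:
  "\<P>(\<omega> in toss_space p. \<tau> n \<alpha> \<beta> A \<omega> = k) = \<P>(\<omega> in toss_space p. hitting n \<alpha> \<beta> \<omega> = k)"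
  unfolding \<tau>_eq_hitting
  by (rule prob_toss_reindex[OF inj_turn_of, where P = "\<lambda>x. hitting n \<alpha> \<beta> x = k"]) measurable

lemma prob_\<tau>_indep:
  "\<P>(\<omega> in toss_space p. \<tau> n \<alpha> \<beta> First \<omega> = k \<and> \<tau> n \<alpha> \<beta> Second \<omega> = l) =
    \<P>(\<omega> in toss_space p. \<tau> n \<alpha> \<beta> First \<omega> = k) * \<P>(\<omega> in toss_space p. \<tau> n \<alpha> \<beta> Second \<omega> = l)"
proof -
  have meas: "Measurable.pred (\<Pi>\<^sub>M t\<in>range (turn_of A). count_space UNIV)
      (\<lambda>\<omega>. \<tau> n \<alpha> \<beta> A \<omega> = k)" for A k
  proof -
    have "(\<lambda>\<omega> j. \<omega> (turn_of A j)) \<in> measurable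
        (\<Pi>\<^sub>M t\<in>range (turn_of A). count_space UNIV) (\<Pi>\<^sub>M t\<in>UNIV. (count_space UNIV :: bool measure))"
      by (intro measurable_PiM_single') (auto simp: space_PiM)
    from measurable_compose[OF this measurable_hitting]
    have [measurable]: "\<tau> n \<alpha> \<beta> A \<in> measurable (\<Pi>\<^sub>M t\<in>range (turn_of A). count_space UNIV) (count_space UNIV)"
      by (simp add: \<tau>_eq_hitting[abs_def])
    show ?thesis
      by measurable
  qed
  have "range (turn_of First) \<inter> range (turn_of Second) = {}"
    by (auto, presburger)
  \<comment> \<open>Unfolding \<open>\<tau>\<close> removes the restrictions, since it reads only
    coordinates in \<open>range (turn_of A)\<close>.\<close>
  from prob_toss_indep[OF this meas meas, of p k l] show ?thesis
    by (simp add: \<tau>_def)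
qed

lemma prob_\<tau>_zero:
  assumes "\<alpha> > 0" "\<beta> > 0" "k \<notin> {\<lceil>n / (\<alpha> + \<beta>)\<rceil>..\<lceil>n / \<alpha>\<rceil>}" "n > 0"
  shows "prob_\<tau>1 p n \<alpha> \<beta> k = 0"
proof -
  \<comment> \<open>Positivity of the hitting time ensures that \<open>nat\<close> in its upper
    bound does not truncate the ceiling.\<close>
  have "int (hitting n \<alpha> \<beta> x) \<in> {\<lceil>n / (\<alpha> + \<beta>)\<rceil>..\<lceil>n / \<alpha>\<rceil>}" for x
    using hitting_lower[OF assms(1,2), of n x] hitting_upper[OF assms(1,2), of n x]
      hitting_pos[OF assms(1,2,4), of x] by auto
  with assms(3) have "int (\<tau> n \<alpha> \<beta> First \<omega>) \<noteq> k" for \<omega>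
    unfolding \<tau>_eq_hitting by metis
  then show ?thesis
    by (simp add: prob_\<tau>1_def)
qed

section \<open>The winning probability\<close>

text \<open>The square runs over all pairs \<open>(k, l)\<close>. By symmetry, twice the part
  \<open>k \<le> l\<close> covers them all but counts the diagonal twice. For probabilities with sum
  1 this is the symmetry argument for \<open>\<tau>\<close>.\<close>

lemma square_sum_ordered_pairs:
  fixes a :: "nat \<Rightarrow> real"
  shows "(\<Sum>k\<le>N. a k)\<^sup>2 = 2 * (\<Sum>l\<le>N. \<Sum>k\<le>l. a k * a l) - (\<Sum>k\<le>N. (a k)\<^sup>2)"
  by (induction N) (auto simp: power2_eq_square algebra_simps sum_distrib_left sum.distrib)

lemma first_win_prob_eq:
  assumes "\<alpha> > 0" "\<beta> > 0" "n > 0"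
  shows "first_win_prob p n \<alpha> \<beta> =
    1/2 * (1 + (\<Sum>k = \<lceil>n / (\<alpha> + \<beta>)\<rceil>..\<lceil>n / \<alpha>\<rceil>. (prob_\<tau>1 p n \<alpha> \<beta> k)\<^sup>2))"
proof -
  interpret prob_space "toss_space p"
    by (rule prob_space_toss_space)
  define a where "a k = \<P>(\<omega> in toss_space p. hitting n \<alpha> \<beta> \<omega> = k)" for k
  define N where "N = nat \<lceil>n / \<alpha>\<rceil>"
  have le_N: "\<tau> n \<alpha> \<beta> A \<omega> \<le> N" for A \<omega>
    unfolding N_def \<tau>_eq_hitting by (rule hitting_upper[OF assms(1,2)])
  have "(\<Sum>k\<le>N. a k) = \<P>(\<omega> in toss_space p. True)"
    unfolding a_def
  proof (rule prob_sum[symmetric])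
    show "{\<omega> \<in> space (toss_space p). hitting n \<alpha> \<beta> \<omega> = k} \<in> events" for k
      by measurable
    show "{\<omega> \<in> space (toss_space p). True} \<in> events"
      by measurable
  qed (auto simp: N_def hitting_upper[OF assms(1,2)])
  then have sum_a: "(\<Sum>k\<le>N. a k) = 1"
    using prob_space by simp
  have "first_win_prob p n \<alpha> \<beta> =
      \<P>(\<omega> in toss_space p. \<tau> n \<alpha> \<beta> First \<omega> \<le> \<tau> n \<alpha> \<beta> Second \<omega>)"
    by (simp add: first_win_prob_def wins_First_iff[OF assms])
  \<comment> \<open>\<open>fst z\<close> is the value for \<open>Second\<close> and
    \<open>snd z\<close> the smaller or equal one for \<open>First\<close>; the bound
    \<open>N\<close> makes the partition finite.\<close>
  also have "\<dots> = (\<Sum>z\<in>Sigma {..N} (\<lambda>l. {..l}).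
      \<P>(\<omega> in toss_space p. \<tau> n \<alpha> \<beta> First \<omega> = snd z \<and> \<tau> n \<alpha> \<beta> Second \<omega> = fst z))"
  proof (rule prob_sum)
    show "{\<omega> \<in> space (toss_space p). \<tau> n \<alpha> \<beta> First \<omega> = snd z \<and> \<tau> n \<alpha> \<beta> Second \<omega> = fst z} \<in> events"
      "{\<omega> \<in> space (toss_space p). \<tau> n \<alpha> \<beta> First \<omega> \<le> \<tau> n \<alpha> \<beta> Second \<omega>} \<in> events" for z
      by measurable
  qed (auto simp: le_N)
  also have "\<dots> = (\<Sum>l\<le>N. \<Sum>k\<le>l. a k * a l)"
    unfolding prob_\<tau>_indep prob_\<tau>_eq a_def by (simp add: sum.Sigma case_prod_unfold)
  also have "\<dots> = 1/2 * (1 + (\<Sum>k\<le>N. (a k)\<^sup>2))"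
    using square_sum_ordered_pairs[of a N] by (simp add: sum_a)
  also have "(\<Sum>k\<le>N. (a k)\<^sup>2) = (\<Sum>k\<le>N. (prob_\<tau>1 p n \<alpha> \<beta> (int k))\<^sup>2)"
    unfolding prob_\<tau>1_def of_nat_eq_iff prob_\<tau>_eq a_def ..
  also have "\<dots> = (\<Sum>k\<in>int ` {..N}. (prob_\<tau>1 p n \<alpha> \<beta> k)\<^sup>2)"
    by (simp add: sum.reindex)
  also have "\<dots> = (\<Sum>k = \<lceil>n / (\<alpha> + \<beta>)\<rceil>..\<lceil>n / \<alpha>\<rceil>. (prob_\<tau>1 p n \<alpha> \<beta> k)\<^sup>2)"
  proof (rule sum.mono_neutral_right)
    show "{\<lceil>n / (\<alpha> + \<beta>)\<rceil>..\<lceil>n / \<alpha>\<rceil>} \<subseteq> int ` {..N}"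
    proof
      fix k assume k: "k \<in> {\<lceil>n / (\<alpha> + \<beta>)\<rceil>..\<lceil>n / \<alpha>\<rceil>}"
      \<comment> \<open>A positive lower end places the integer interval inside the image of the
        naturals; the other indices contribute zero.\<close>
      have "0 < \<lceil>n / (\<alpha> + \<beta>)\<rceil>"
        using assms by simp
      with k have "k > 0"
        by (meson atLeastAtMost_iff less_le_trans)
      with k have "k = int (nat k)" "nat k \<le> N"
        by (auto simp: N_def)
      then show "k \<in> int ` {..N}"
        by blast
    qed
  qed (auto simp: prob_\<tau>_zero assms)
  finally show ?thesis .
qed

theorem theorem1:
  fixes \<alpha> \<beta> n p q :: real
  assumes "\<alpha> > 0" and "\<beta> > 0" and "n > 0"
    and "p \<in> {0..1}" and "q = 1 - p"
  shows "(\<lambda>k::int. (prob_\<tau>1 p n \<alpha> \<beta> k)\<^sup>2) summable_on UNIV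
    \<and> first_win_prob p n \<alpha> \<beta> = 1/2 * (1 + (\<Sum>\<^sub>\<infinity>k::int. (prob_\<tau>1 p n \<alpha> \<beta> k)\<^sup>2))
    \<and> first_win_prob p n \<alpha> \<beta> =
        1/2 * (1 + (\<Sum>k = \<lceil>n / (\<alpha> + \<beta>)\<rceil>..\<lceil>n / \<alpha>\<rceil>. (prob_\<tau>1 p n \<alpha> \<beta> k)\<^sup>2))
    \<and> (\<forall>k \<in> {\<lceil>n / (\<alpha> + \<beta>)\<rceil>..\<lceil>n / \<alpha>\<rceil>}.
         let i = \<lceil>(n - of_int k * \<alpha>) / \<beta> - 1\<rceil>;
             i' = \<lceil>(n - (of_int k - 1) * \<alpha>) / \<beta> - 1\<rceil>
         in prob_\<tau>1 p n \<alpha> \<beta> k =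
              ibinom (k - 1) i * p powi (i + 1) * q powi (k - i - 1)
              + (\<Sum>j = i + 1..i'. ibinom (k - 1) j * p powi j * q powi (k - j - 1)))"
proof (intro conjI ballI)
  let ?I = "{\<lceil>n / (\<alpha> + \<beta>)\<rceil>..\<lceil>n / \<alpha>\<rceil>}"
  \<comment> \<open>All nonzero terms lie in the finite set \<open>?I\<close>, which yields both
    summability and the reduction of the infinite sum.\<close>
  have zero: "(prob_\<tau>1 p n \<alpha> \<beta> k)\<^sup>2 = 0" if "k \<in> UNIV - ?I" for k
    using that prob_\<tau>_zero[OF assms(1,2) _ assms(3)] by simp
  show "(\<lambda>k::int. (prob_\<tau>1 p n \<alpha> \<beta> k)\<^sup>2) summable_on UNIV"
    using summable_on_cong_neutral[of ?I UNIV "\<lambda>k. (prob_\<tau>1 p n \<alpha> \<beta> k)\<^sup>2"] zero by simp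
  have "(\<Sum>\<^sub>\<infinity>k::int. (prob_\<tau>1 p n \<alpha> \<beta> k)\<^sup>2) = (\<Sum>k\<in>?I. (prob_\<tau>1 p n \<alpha> \<beta> k)\<^sup>2)"
    using infsum_cong_neutral[of UNIV ?I "\<lambda>k. (prob_\<tau>1 p n \<alpha> \<beta> k)\<^sup>2"] zero by simp
  with first_win_prob_eq[OF assms(1-3)]
  show "first_win_prob p n \<alpha> \<beta> = 1/2 * (1 + (\<Sum>\<^sub>\<infinity>k::int. (prob_\<tau>1 p n \<alpha> \<beta> k)\<^sup>2))"
    by simp
  show "first_win_prob p n \<alpha> \<beta> = 1/2 * (1 + (\<Sum>k\<in>?I. (prob_\<tau>1 p n \<alpha> \<beta> k)\<^sup>2))"
    by (rule first_win_prob_eq[OF assms(1-3)])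
next
  fix k assume "k \<in> {\<lceil>n / (\<alpha> + \<beta>)\<rceil>..\<lceil>n / \<alpha>\<rceil>}"
  moreover have "0 < \<lceil>n / (\<alpha> + \<beta>)\<rceil>"
    using assms by simp
  ultimately have "k > 0"
    by (meson atLeastAtMost_iff less_le_trans)
  then obtain m where k: "k = int (Suc m)"
    by (metis gr0_conv_Suc zero_less_imp_eq_int)
  have "prob_\<tau>1 p n \<alpha> \<beta> k = \<P>(\<omega> in toss_space p. hitting n \<alpha> \<beta> \<omega> = Suc m)"
    unfolding prob_\<tau>1_def k of_nat_eq_iff by (rule prob_\<tau>_eq)
  moreover have "real_of_int k = real (Suc m)" "real_of_int k - 1 = real m" "k - 1 = int m"
    "k - j - 1 = int m - j" for j
    by (simp_all add: k)
  ultimately show "let i = \<lceil>(n - of_int k * \<alpha>) / \<beta> - 1\<rceil>;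
             i' = \<lceil>(n - (of_int k - 1) * \<alpha>) / \<beta> - 1\<rceil>
         in prob_\<tau>1 p n \<alpha> \<beta> k =
              ibinom (k - 1) i * p powi (i + 1) * q powi (k - i - 1)
              + (\<Sum>j = i + 1..i'. ibinom (k - 1) j * p powi j * q powi (k - j - 1))"
    using prob_hitting_Suc[OF assms(1,2,4), of n m] by (simp only: Let_def assms(5))
qed

end
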